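(* Let $n\ge1$. The baseball construction $\mathcal G\mapsto \pi(\mathcal G)$ is a bijection from the set of torsion classes in $A_{n-1}$ to the set of 213-avoiding permutations of $\{1,\dots,n\}$.
   Context: A permutation $p=(m_1,\dots,m_n)$ of $\{1,\dots,n\}$ is 213-avoiding if there are no indices $i<j<k$ with $m_j<m_i<m_k$. Torsion classes in $A_{n-1}$. The objects are balls arranged in a triangle with $n-1$ balls in the bottom row, indexed by pairs $[i,j]$ with $1\le i\le j\le n-1$, with $[i,j]$ drawn at the point $\left(\tfrac{i+j}2,\tfrac{j-i}2\right)$ (no balls if $n=1$). They represent the indecomposable representations of the linearly oriented quiver $A_{n-1}$. $\mathrm{Hom}(X,Y)\neq0$ iff the entire rectangle with left corner $X$ and right corner $Y$ lies in the triangle; explicitly, $\mathrm{Hom}([i,j],[i',j'])\ne0$ iff $i\le i'\le j\le j'$. A pair $(\mathcal G,\mathcal F)$ of subsets of balls is a torsion pair if $\mathcal G=\{X:\mathrm{Hom}(X,Y)=0\ \forall\,Y\in\mathcal F\}$ and $\mathcal F=\{Y:\mathrm{Hom}(X,Y)=0\ \forall\,X\in\mathcal G\}$; a torsion class is the set $\mathcal G$ of some torsion pair. Baseball construction. Given a torsion class $\mathcal G$, call each ball in $\mathcal G$ a baseball and each ball not in $\mathcal G$ a cross-ball. Draw a wire diagram with $n$ wires entering from the right, labeled $1,2,\dots,n$ from top to bottom, and travelling to the left through the balls. Each ball is met by two wires at adjacent heights; at a baseball the two wires do not cross (each keeps its height), and at a cross-ball the two wires cross (exchange heights). The permutation $\pi(\mathcal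 G)$ is the sequence of wire labels read from top to bottom at the left end. Explicitly: start with the sequence $(1,2,\dots,n)$ and process the balls $[i,j]$ in order of decreasing $i+j$ (balls with equal $i+j$ act on disjoint positions, so their order is irrelevant). For a ball $[i,j]$ let $k=n-1-(j-i)$; if $[i,j]\notin\mathcal G$, exchange the entries in positions $k$ and $k+1$ of the current sequence, and if $[i,j]\in\mathcal G$, do nothing. The final sequence is $\pi(\mathcal G)$. *)

theory Defs
  imports "HOL-Combinatorics.Multiset_Permutations"
begin

section \<open>213-avoiding permutations\<close>

text \<open>A permutation of \<open>{1..n}\<close> is the list of its values, an element of
  \<^term>\<open>permutations_of_set {1..n}\<close>.\<close>

definition avoids_213 :: "nat list \<Rightarrow> bool" where
  "avoids_213 p \<longleftrightarrow>
     \<not> (\<exists>i j k. i < j \<and> j < k \<and> k < length p \<and> p ! j < p ! i \<and> p ! i < p ! k)"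

section \<open>Torsion classes in the linearly oriented quiver of type A with n - 1 vertices\<close>

type_synonym ball = "nat \<times> nat"

definition balls :: "nat \<Rightarrow> ball set" where
  "balls n = {(i, j). 1 \<le> i \<and> i \<le> j \<and> j \<le> n - 1}"

text \<open>\<open>hom_nonzero X Y\<close> says \<open>Hom(X, Y) \<noteq> 0\<close>.\<close>

fun hom_nonzero :: "ball \<Rightarrow> ball \<Rightarrow> bool" where
  "hom_nonzero (i, j) (i', j') \<longleftrightarrow> i \<le> i' \<and> i' \<le> j \<and> j \<le> j'"

definition torsion_pair :: "nat \<Rightarrow> ball set \<Rightarrow> ball set \<Rightarrow> bool" where
  "torsion_pair n G F \<longleftrightarrow>
     G \<subseteq> balls n \<and> F \<subseteq> balls n \<and>
     G = {X \<in> balls n. \<forall>Y\<in>F. \<not> hom_nonzero X Y} \<and>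
     F = {Y \<in> balls n. \<forall>X\<in>G. \<not> hom_nonzero X Y}"

definition torsion_class :: "nat \<Rightarrow> ball set \<Rightarrow> bool" where
  "torsion_class n G \<longleftrightarrow> (\<exists>F. torsion_pair n G F)"

section \<open>The baseball construction\<close>

text \<open>Positions count from 1, list indices from 0.\<close>

definition exchange :: "nat \<Rightarrow> nat list \<Rightarrow> nat list" where
  "exchange k xs = xs[k - 1 := xs ! k, k := xs ! (k - 1)]"

fun ball_step :: "nat \<Rightarrow> ball set \<Rightarrow> ball \<Rightarrow> nat list \<Rightarrow> nat list" where
  "ball_step n G (i, j) xs =
     (if (i, j) \<in> G then xs else exchange (n - 1 - (j - i)) xs)"

text \<open>The balls by decreasing \<open>i + j\<close>, ties broken by increasing \<open>i\<close>;
  lemma \<open>baseball_order_irrelevant\<close> shows that any other way of breaking ties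
  gives the same result.\<close>

definition ball_order :: "nat \<Rightarrow> ball list" where
  "ball_order n =
     concat (map (\<lambda>s. map (\<lambda>i. (i, s - i)) (filter (\<lambda>i. (i, s - i) \<in> balls n) [1..<n]))
                 (rev [2..<2 * n - 1]))"

definition baseball :: "nat \<Rightarrow> ball set \<Rightarrow> nat list" where
  "baseball n G = fold (ball_step n G) (ball_order n) [1..<n + 1]"

definition admissible_order :: "nat \<Rightarrow> ball list \<Rightarrow> bool" where
  "admissible_order n bs \<longleftrightarrow>
     distinct bs \<and> set bs = balls n \<and>
     sorted_wrt (\<lambda>X Y. fst X + snd X \<ge> fst Y + snd Y) bs"

lemma admissible_ball_order: "admissible_order n (ball_order n)"
proof -
  define row where "row s = map (\<lambda>i. (i, s - i))
    (filter (\<lambda>i. (i, s - i) \<in> balls n) [1..<n])" for s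
  have mem: "x \<in> set (row s) \<longleftrightarrow> x \<in> balls n \<and> fst x + snd x = s" for x s
  proof (cases x)
    case (Pair i j)
    show ?thesis
      unfolding Pair row_def by (auto simp: balls_def image_iff)
  qed
  have dist: "distinct (row s)" for s
    unfolding row_def by (auto simp: distinct_map inj_on_def)
  have rows: "distinct (concat (map row ss)) \<and>
      sorted_wrt (\<lambda>X Y. fst X + snd X \<ge> fst Y + snd Y) (concat (map row ss))"
    if "sorted_wrt (>) ss" for ss
    using that
  proof (induction ss)
    case Nil
    then show ?case by simp
  next
    case (Cons s ss)
    have "sorted_wrt (\<lambda>X Y. fst X + snd X \<ge> fst Y + snd Y) (row s)"
      by (rule sorted_wrt_mono_rel[of _ "\<lambda>_ _. True"]) (auto simp: mem sorted_wrt_iff_nth_less)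
    then show ?case
      using Cons by (auto simp: mem dist sorted_wrt_append less_imp_le)
  qed
  have "sorted_wrt (>) (rev [2..<2 * n - 1])"
    by (simp add: sorted_wrt_rev)
  note rows[OF this]
  moreover have "set (concat (map row (rev [2..<2 * n - 1]))) = balls n"
    by (auto simp: mem) (auto simp: balls_def)
  ultimately show ?thesis
    unfolding admissible_order_def ball_order_def row_def[symmetric] by simp
qed

lemma exchange_commute:
  assumes "k + 2 \<le> l" "1 \<le> k"
  shows "exchange k (exchange l xs) = exchange l (exchange k xs)"
proof -
  have neq: "k - 1 \<noteq> l - 1" "k - 1 \<noteq> l" "k \<noteq> l - 1" "k \<noteq> l" using assms by auto
  have upd: "xs[a := p, b := q, c := r, d := t] = xs[c := r, d := t, a := p, b := q]"
    if "a \<noteq> c" "a \<noteq> d" "b \<noteq> c" "b \<noteq> d" for a b c d p q r t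
    using that by (simp only: list_update_swap[of a c] list_update_swap[of a d]
      list_update_swap[of b c] list_update_swap[of b d] not_False_eq_True)
  show ?thesis
    unfolding exchange_def
    using upd[OF neq(1)[symmetric] neq(3)[symmetric] neq(2)[symmetric] neq(4)[symmetric]]
    by (simp only: nth_list_update_neq neq neq[symmetric] not_False_eq_True)
qed

lemma ball_step_commute:
  assumes "X \<in> balls n" "Y \<in> balls n" "fst X + snd X = fst Y + snd Y"
  shows "ball_step n G X (ball_step n G Y xs) = ball_step n G Y (ball_step n G X xs)"
proof -
  obtain i j where X: "X = (i, j)" by force
  obtain i' j' where Y: "Y = (i', j')" by force
  have b: "1 \<le> i" "i \<le> j" "j \<le> n - 1" "1 \<le> i'" "i' \<le> j'" "j' \<le> n - 1"
    "i + j = i' + j'"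
    using assms unfolding X Y balls_def by auto
  define d d' where "d = j - i" and "d' = j' - i'"
  have "j = i + d" "j' = i' + d'" using b unfolding d_def d'_def by simp_all
  then have sum: "2 * i + d = 2 * i' + d'" and bound: "d + 1 < n" "d' + 1 < n"
    using b by linarith+
  from sum have "d = d' \<or> d + 2 \<le> d' \<or> d' + 2 \<le> d" by presburger
  moreover note bound
  moreover define k l where "k = n - 1 - d" and "l = n - 1 - d'"
  moreover have "d + k = n - 1" "d' + l = n - 1" using calculation by simp_all
  ultimately have "k + 2 \<le> l \<and> 1 \<le> k \<or> l + 2 \<le> k \<and> 1 \<le> l \<or> k = l"
    by linarith
  then have "exchange k (exchange l xs) = exchange l (exchange k xs)"
    by (metis exchange_commute)
  then show ?thesis
    unfolding X Y ball_step.simps d_def[symmetric] d'_def[symmetric]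
      k_def[symmetric] l_def[symmetric]
    by (cases "(i, j) \<in> G"; cases "(i', j') \<in> G") simp_all
qed

lemma fold_sorted_order_irrelevant:
  fixes key :: "'a \<Rightarrow> nat"
  assumes comm: "\<And>x y s. x \<in> A \<Longrightarrow> y \<in> A \<Longrightarrow> key x = key y \<Longrightarrow> f x (f y s) = f y (f x s)"
  shows "distinct xs \<Longrightarrow> distinct ys \<Longrightarrow> set xs = set ys \<Longrightarrow> set xs \<subseteq> A \<Longrightarrow>
    sorted_wrt (\<lambda>x y. key x \<ge> key y) xs \<Longrightarrow> sorted_wrt (\<lambda>x y. key x \<ge> key y) ys \<Longrightarrow>
    fold f xs s = fold f ys s"
proof (induction xs arbitrary: ys s)
  case Nil
  then show ?case by simp
next
  case (Cons x xs)
  then obtain as bs where ys: "ys = as @ x # bs"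
    by (metis list.set_intros(1) split_list)
  have as: "set as \<subseteq> A" "x \<in> A" "\<forall>a\<in>set as. key a = key x"
    using Cons.prems unfolding ys by (auto simp: sorted_wrt_append intro!: antisym)
  have "fold f as (f x s) = f x (fold f as s)" for s
    using as
  proof (induction as arbitrary: s)
    case (Cons a as)
    have "f a (f x s) = f x (f a s)" using Cons.prems by (intro comm) auto
    then show ?case using Cons by simp
  qed simp
  moreover have "fold f xs (f x s) = fold f (as @ bs) (f x s)"
    by (rule Cons.IH) (use Cons.prems in \<open>auto simp: ys sorted_wrt_append\<close>)
  ultimately show ?case unfolding ys by simp
qed

lemma baseball_order_irrelevant:
  assumes "admissible_order n bs"
  shows "baseball n G = fold (ball_step n G) bs [1..<n + 1]"
  unfolding baseball_def
  by (rule fold_sorted_order_irrelevant[where A = "balls n" and key = "\<lambda>X. fst X + snd X"])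
     (use assms admissible_ball_order[of n] in
       \<open>auto simp: admissible_order_def intro: ball_step_commute\<close>)

end

theory Submission
  imports Defs
begin

text \<open>The balls may be processed column by column: by decreasing \<open>j\<close> and, for equal \<open>j\<close>, by
  decreasing \<open>i\<close>. A torsion class meets column \<open>j\<close> in the balls \<open>[i, j]\<close> with \<open>c j < i\<close>, for some
  \<open>c j \<le> j\<close>, so its cross-balls \<open>[c j, j], \<dots>, [1, j]\<close> select the entry with exactly \<open>c j\<close>
  predecessors among the last \<open>j + 1\<close> entries and move it in front of them. Hence \<open>c\<close>, read backwards,
  is the Lehmer code of \<open>\<pi>(\<G>)\<close>. A family \<open>c\<close> comes from a torsion class iff \<open>c k \<le> j\<close> implies
  \<open>c k \<le> c j\<close> for all \<open>j < k\<close> (closure under extensions), and this is 213-avoidance expressed in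
  the Lehmer code.\<close>

section \<open>Lehmer codes\<close>

definition remove_nth :: "nat \<Rightarrow> 'a list \<Rightarrow> 'a list" where
  "remove_nth i xs = take i xs @ drop (Suc i) xs"

text \<open>The code is indexed from the right: \<open>c j\<close> belongs to the entry followed by \<open>j\<close> others.\<close>

primrec decode :: "(nat \<Rightarrow> nat) \<Rightarrow> nat \<Rightarrow> 'a list \<Rightarrow> 'a list" where
  "decode c 0 xs = []"
| "decode c (Suc k) xs = xs ! c k # decode c k (remove_nth (c k) xs)"

text \<open>The right inversion count. Positions run from the left, code indices from the right: in
  a word of length \<open>n\<close>, position \<open>p\<close> matches index
  \<open>n - 1 - p\<close>.\<close>

definition lehmer :: "'a::linorder list \<Rightarrow> nat \<Rightarrow> nat" where
  "lehmer w p = card {v \<in> set (drop (Suc p) w). v < w ! p}"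

lemma length_remove_nth: "i < length xs \<Longrightarrow> length (remove_nth i xs) = length xs - 1"
  by (simp add: remove_nth_def)

lemma set_remove_nth:
  assumes "distinct xs" "i < length xs"
  shows "set (remove_nth i xs) = set xs - {xs ! i}"
proof -
  have "distinct (take i xs @ xs ! i # drop (Suc i) xs)"
    using assms by (simp add: id_take_nth_drop[symmetric])
  moreover have "set xs = set (take i xs @ xs ! i # drop (Suc i) xs)"
    using assms by (simp add: id_take_nth_drop[symmetric])
  ultimately show ?thesis
    by (auto simp: remove_nth_def)
qed

lemma sorted_wrt_remove_nth: "sorted_wrt R xs \<Longrightarrow> sorted_wrt R (remove_nth i xs)"
proof (cases "i < length xs")
  case True
  assume "sorted_wrt R xs"
  then have "sorted_wrt R (take i xs @ xs ! i # drop (Suc i) xs)"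
    using True by (simp add: id_take_nth_drop[symmetric])
  then show ?thesis by (simp add: remove_nth_def sorted_wrt_append)
qed (simp add: remove_nth_def)

lemma decode_cong: "(\<And>j. j < k \<Longrightarrow> c j = d j) \<Longrightarrow> decode c k xs = decode d k xs"
  by (induction k arbitrary: xs) auto

lemma length_decode [simp]: "length (decode c k xs) = k"
  by (induction k arbitrary: xs) auto

lemma decode_permutation:
  assumes "sorted_wrt (<) (xs :: 'a::linorder list)" "length xs = k" "\<And>j. j < k \<Longrightarrow> c j \<le> j"
  shows "set (decode c k xs) = set xs \<and> distinct (decode c k xs)"
  using assms
proof (induction k arbitrary: xs)
  case (Suc k)
  have c: "c k < length xs" and dist: "distinct xs"
    using Suc.prems(2) Suc.prems(3)[of k] Suc.prems(1) by (auto simp: strict_sorted_iff)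
  have "set (decode c k (remove_nth (c k) xs)) = set xs - {xs ! c k} \<and>
      distinct (decode c k (remove_nth (c k) xs))"
    using Suc.IH[of "remove_nth (c k) xs"] Suc.prems c
    by (simp add: sorted_wrt_remove_nth length_remove_nth set_remove_nth dist)
  then show ?case using c by (auto simp: insert_absorb)
qed simp

lemma card_less_nth:
  assumes "sorted_wrt (<) (xs :: 'a::linorder list)" "i < length xs"
  shows "card {v \<in> set xs. v < xs ! i} = i"
proof -
  have "sorted_wrt (<) (take i xs @ xs ! i # drop (Suc i) xs)"
    using assms by (simp add: id_take_nth_drop[symmetric])
  moreover have "set xs = set (take i xs @ xs ! i # drop (Suc i) xs)"
    using assms by (simp add: id_take_nth_drop[symmetric])
  ultimately have "{v \<in> set xs. v < xs ! i} = set (take i xs)"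
    by (auto simp: sorted_wrt_append)
  then show ?thesis
    using assms by (simp add: distinct_card strict_sorted_iff)
qed

text \<open>Exactly \<open>c k\<close> entries of a strictly sorted list lie below the one at index
  \<open>c k\<close>, and all of them are still to be placed. Removal keeps the list sorted. Thus
  \<open>c\<close> can be read off the word, which later gives injectivity.\<close>

lemma lehmer_decode:
  assumes "sorted_wrt (<) (xs :: 'a::linorder list)" "length xs = k" "\<And>j. j < k \<Longrightarrow> c j \<le> j" "p < k"
  shows "lehmer (decode c k xs) p = c (k - 1 - p)"
  using assms
proof (induction k arbitrary: xs p)
  case (Suc k)
  let ?ys = "remove_nth (c k) xs"
  have c: "c k < length xs" and dist: "distinct xs"
    using Suc.prems(2) Suc.prems(3)[of k] Suc.prems(1) by (auto simp: strict_sorted_iff)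
  have ys: "sorted_wrt (<) ?ys" "length ?ys = k"
    using Suc.prems c by (simp_all add: sorted_wrt_remove_nth length_remove_nth)
  show ?case
  proof (cases p)
    case 0
    have "{v \<in> set (decode c k ?ys). v < xs ! c k} = {v \<in> set xs. v < xs ! c k}"
      using decode_permutation[OF ys, of c] Suc.prems(3) by (auto simp: set_remove_nth dist c)
    then show ?thesis
      using card_less_nth[OF Suc.prems(1) c] 0 by (simp add: lehmer_def)
  next
    case (Suc q)
    then show ?thesis
      using Suc.IH[OF ys, of q] Suc.prems by (simp add: lehmer_def)
  qed
qed simp

lemma decode_surj:
  assumes "sorted_wrt (<) (xs :: 'a::linorder list)" "length xs = k" "distinct w" "set w = set xs"
  shows "\<exists>c. (\<forall>j<k. c j \<le> j) \<and> decode c k xs = w"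
  using assms
proof (induction k arbitrary: xs w)
  case (Suc k)
  have dist: "distinct xs" using Suc.prems by (simp add: strict_sorted_iff)
  obtain x ys where w: "w = x # ys"
    using Suc.prems by (cases w) auto
  obtain i where i: "i < length xs" "xs ! i = x"
    using Suc.prems(4) w by (metis in_set_conv_nth list.set_intros(1))
  have "set ys = set (remove_nth i xs)"
    using Suc.prems w i by (auto simp: set_remove_nth dist)
  then obtain c where c: "\<forall>j<k. c j \<le> j" "decode c k (remove_nth i xs) = ys"
    using Suc.IH[of "remove_nth i xs" ys] Suc.prems i w
    by (auto simp: sorted_wrt_remove_nth length_remove_nth)
  \<comment> \<open>The tail uses only code values below \<open>k\<close>, so the value at
    \<open>k\<close> is free to record the index of the first letter.\<close>
  have "decode (c(k := i)) k (remove_nth i xs) = ys"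
    using c(2) decode_cong[of k "c(k := i)" c "remove_nth i xs"] by simp
  then have "decode (c(k := i)) (Suc k) xs = w"
    using i w by (simp only: decode.simps fun_upd_same)
  moreover have "\<forall>j<Suc k. (c(k := i)) j \<le> j"
    using c(1) i Suc.prems by (auto simp: less_Suc_eq)
  ultimately show ?case by blast
qed simp

section \<open>213-avoidance in terms of the Lehmer code\<close>

lemma set_drop_conv_nth: "set (drop m w) = {w ! s | s. m \<le> s \<and> s < length w}"
proof safe
  fix v assume "v \<in> set (drop m w)"
  then obtain t where "t < length w - m" "v = w ! (m + t)"
    by (auto simp: in_set_conv_nth)
  then show "\<exists>s. v = w ! s \<and> m \<le> s \<and> s < length w"
    by (intro exI[of _ "m + t"]) auto
next
  fix s assume "m \<le> s" "s < length w"
  then show "w ! s \<in> set (drop m w)"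
    by (auto simp: in_set_conv_nth intro!: exI[of _ "s - m"])
qed

text \<open>Here \<open>n - 1 - q\<close> counts the entries after \<open>q\<close>. If
  \<open>w ! p < w ! q\<close>, avoidance forces every later entry below \<open>w ! p\<close> to
  come after \<open>q\<close>, where it is counted for \<open>q\<close> too; otherwise the premise
  on \<open>n - 1 - q\<close> fails.\<close>

lemma avoids_213_iff_lehmer:
  assumes "distinct w" "length w = n"
  shows "avoids_213 w \<longleftrightarrow>
    (\<forall>p q. p < q \<longrightarrow> q < n \<longrightarrow> lehmer w p \<le> n - 1 - q \<longrightarrow> lehmer w p \<le> lehmer w q)"
    (is "_ \<longleftrightarrow> ?C")
proof
  assume av: "avoids_213 w"
  show ?C
  proof (intro allI impI)
    fix p q
    assume pq: "p < q" "q < n" and le: "lehmer w p \<le> n - 1 - q"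
    have ne: "w ! p \<noteq> w ! q" using assms pq by (simp add: nth_eq_iff_index_eq)
    show "lehmer w p \<le> lehmer w q"
    proof (cases "w ! p < w ! q")
      case True
      have "{v \<in> set (drop (Suc p) w). v < w ! p} \<subseteq> {v \<in> set (drop (Suc q) w). v < w ! q}"
      proof safe
        fix v assume v: "v \<in> set (drop (Suc p) w)" "v < w ! p"
        then obtain s where s: "Suc p \<le> s" "s < length w" "v = w ! s"
          by (auto simp: set_drop_conv_nth)
        have "\<not> s < q" using av s v pq True assms unfolding avoids_213_def by auto
        moreover have "s \<noteq> q" using s v True by auto
        ultimately have "Suc q \<le> s" by simp
        then show "v \<in> set (drop (Suc q) w)" using s by (auto simp: set_drop_conv_nth)
        show "v < w ! q" using v True by simp
      qed
      then show ?thesis unfolding lehmer_def by (intro card_mono) auto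
    next
      case False
      \<comment> \<open>A larger entry after \<open>q\<close> would complete a 213 pattern. So all
        \<open>n - q\<close> entries from \<open>q\<close> on are counted at \<open>p\<close>,
        against the premise.\<close>
      have "set (drop q w) \<subseteq> {v \<in> set (drop (Suc p) w). v < w ! p}"
      proof
        fix v assume "v \<in> set (drop q w)"
        then obtain s where s: "q \<le> s" "s < length w" "v = w ! s"
          by (auto simp: set_drop_conv_nth)
        have "\<not> w ! p < w ! s"
        proof (cases "s = q")
          case False
          then show ?thesis
            using av s pq \<open>\<not> w ! p < w ! q\<close> ne unfolding avoids_213_def
            by (metis linorder_neqE_nat le_neq_implies_less)
        qed (use \<open>\<not> w ! p < w ! q\<close> in simp)
        moreover have "w ! p \<noteq> w ! s" using assms pq s by (simp add: nth_eq_iff_index_eq)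
        ultimately show "v \<in> {v \<in> set (drop (Suc p) w). v < w ! p}"
          using s pq by (auto simp: set_drop_conv_nth)
      qed
      then have "card (set (drop q w)) \<le> lehmer w p"
        unfolding lehmer_def by (intro card_mono) auto
      then show ?thesis using le assms pq by (simp add: distinct_card)
    qed
  qed
next
  assume C: ?C
  show "avoids_213 w"
    unfolding avoids_213_def
  proof safe
    fix p q0 r
    assume a: "p < q0" "q0 < r" "r < length w" "w ! q0 < w ! p" "w ! p < w ! r"
    \<comment> \<open>The earliest smaller entry still completes the pattern, and everything counted
      at \<open>p\<close> now lies at or after \<open>q\<close>.\<close>
    define q where "q = (LEAST q. p < q \<and> w ! q < w ! p)"
    have q: "p < q" "w ! q < w ! p"
      using LeastI[of "\<lambda>q. p < q \<and> w ! q < w ! p" q0] a unfolding q_def by auto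
    have first: "q \<le> s" if "p < s" "w ! s < w ! p" for s
      using that unfolding q_def by (auto intro: Least_le)
    have qr: "q < r" using first[of q0] a by simp
    have "{v \<in> set (drop (Suc q) w). v < w ! q} \<subset> {v \<in> set (drop (Suc p) w). v < w ! p}"
    proof (rule psubsetI)
      show "{v \<in> set (drop (Suc q) w). v < w ! q} \<subseteq> {v \<in> set (drop (Suc p) w). v < w ! p}"
        using q by (fastforce simp: set_drop_conv_nth)
      have "w ! q \<in> {v \<in> set (drop (Suc p) w). v < w ! p}"
        using q qr a by (fastforce simp: set_drop_conv_nth)
      then show "{v \<in> set (drop (Suc q) w). v < w ! q} \<noteq> {v \<in> set (drop (Suc p) w). v < w ! p}"
        by blast
    qed
    then have "lehmer w q < lehmer w p"
      unfolding lehmer_def by (intro psubset_card_mono) auto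
    then have "n - 1 - q < lehmer w p"
      using C q qr a assms by (meson leD less_trans not_le)
    \<comment> \<open>The entry \<open>w ! r\<close> lies after \<open>q\<close> but is not counted
      at \<open>p\<close>, which leaves at most \<open>n - q - 1\<close> entries.\<close>
    moreover have "{v \<in> set (drop (Suc p) w). v < w ! p} \<subseteq> set (drop q w) - {w ! r}"
      using first a by (fastforce simp: set_drop_conv_nth)
    then have "lehmer w p \<le> card (set (drop q w) - {w ! r})"
      unfolding lehmer_def by (intro card_mono) auto
    moreover have "w ! r \<in> set (drop q w)" using qr a by (auto simp: set_drop_conv_nth)
    then have "card (set (drop q w) - {w ! r}) = n - q - 1"
      using assms by (simp add: distinct_card)
    ultimately show False by simp
  qed
qed

section \<open>Torsion classes as codes\<close>

text \<open>The second clause encodes extensions: if \<open>c j < j\<close>, then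
  \<open>[c j + 1, j]\<close> and \<open>[j + 1, k]\<close> yield \<open>[c j + 1, k]\<close>. Index
  \<open>0\<close> has no column; it belongs to the last entry of the word.\<close>

definition torsion_code :: "nat \<Rightarrow> (nat \<Rightarrow> nat) \<Rightarrow> bool" where
  "torsion_code n c \<longleftrightarrow> (\<forall>j<n. c j \<le> j) \<and> (\<forall>j k. j < k \<longrightarrow> k < n \<longrightarrow> c k \<le> j \<longrightarrow> c k \<le> c j)"

definition class_of_code :: "nat \<Rightarrow> (nat \<Rightarrow> nat) \<Rightarrow> ball set" where
  "class_of_code n c = {(i, j) \<in> balls n. c j < i}"

text \<open>A nonzero map out of the quotient \<open>(i', j)\<close> yields one out of
  \<open>(i, j)\<close>.\<close>

lemma torsion_class_quotient:
  assumes "torsion_class n G" "(i, j) \<in> G" "i \<le> i'" "i' \<le> j"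
  shows "(i', j) \<in> G"
proof -
  obtain F where F: "torsion_pair n G F" using assms by (auto simp: torsion_class_def)
  then have G: "X \<in> G \<longleftrightarrow> X \<in> balls n \<and> (\<forall>Y\<in>F. \<not> hom_nonzero X Y)" for X
    unfolding torsion_pair_def by blast
  show ?thesis
    using assms unfolding G by (fastforce simp: balls_def)
qed

text \<open>A nonzero map from \<open>(i, k)\<close> to \<open>(y, z)\<close> gives one from
  \<open>(i, j)\<close> if \<open>y \<le> j\<close>, and one from \<open>(Suc j, k)\<close>
  otherwise.\<close>

lemma torsion_class_extension:
  assumes "torsion_class n G" "(i, j) \<in> G" "(Suc j, k) \<in> G"
  shows "(i, k) \<in> G"
proof -
  obtain F where F: "torsion_pair n G F" using assms by (auto simp: torsion_class_def)
  then have G: "X \<in> G \<longleftrightarrow> X \<in> balls n \<and> (\<forall>Y\<in>F. \<not> hom_nonzero X Y)" for X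
    unfolding torsion_pair_def by blast
  have b: "(i, j) \<in> balls n" "(Suc j, k) \<in> balls n" using assms G by auto
  have "\<not> hom_nonzero (i, k) Y" if "Y \<in> F" for Y
  proof -
    obtain y z where Y: "Y = (y, z)" by force
    have "\<not> hom_nonzero (i, j) Y" "\<not> hom_nonzero (Suc j, k) Y"
      using assms that G by auto
    then show ?thesis using b by (auto simp: Y balls_def not_less_eq_eq)
  qed
  then show ?thesis using b unfolding G by (auto simp: balls_def)
qed

lemma torsion_class_imp_code:
  assumes "torsion_class n G"
  shows "\<exists>c. torsion_code n c \<and> G = class_of_code n c"
proof -
  have GB: "G \<subseteq> balls n" using assms by (auto simp: torsion_class_def torsion_pair_def)
  \<comment> \<open>Closure under quotients makes each column upward closed in \<open>i\<close>,
    hence determined by this cutoff; \<open>c j = j\<close> means that column \<open>j\<close>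
    misses \<open>G\<close>.\<close>
  define c where "c j = (LEAST c. \<forall>i. c < i \<longrightarrow> i \<le> j \<longrightarrow> (i, j) \<in> G)" for j
  have c_le: "c j \<le> j" for j unfolding c_def by (rule Least_le) auto
  have "\<forall>i. c j < i \<longrightarrow> i \<le> j \<longrightarrow> (i, j) \<in> G" for j
    unfolding c_def by (rule LeastI[of _ j]) simp
  then have c_in: "(i, j) \<in> G" if "c j < i" "i \<le> j" for i j
    using that by blast
  have in_c: "c j < i" if "(i, j) \<in> G" for i j
  proof -
    have "1 \<le> i" using that GB by (auto simp: balls_def)
    moreover have "c j \<le> i - 1"
      unfolding c_def
      by (rule Least_le) (use torsion_class_quotient[OF assms that] in auto)
    ultimately show ?thesis by simp
  qed
  have "c k \<le> c j" if "j < k" "c k \<le> j" for j k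
  proof (cases "c j < j")
    case True
    have "(Suc (c j), k) \<in> G"
      by (rule torsion_class_extension[OF assms, of _ j]) (use that True in \<open>auto intro: c_in\<close>)
    then show ?thesis using in_c by fastforce
  next
    case False
    then show ?thesis using that by simp
  qed
  then have "torsion_code n c" using c_le by (auto simp: torsion_code_def)
  moreover have "G = class_of_code n c"
    using GB c_in in_c unfolding class_of_code_def by (auto simp: balls_def)
  ultimately show ?thesis by blast
qed

text \<open>With \<open>F\<close> the right Hom-orthogonal of the class, it remains to map each ball
  outside the class nontrivially to a ball of \<open>F\<close>.\<close>

lemma torsion_class_of_code:
  assumes "torsion_code n c"
  shows "torsion_class n (class_of_code n c)"
proof -
  let ?G = "class_of_code n c"
  define F where "F = {Y \<in> balls n. \<forall>X\<in>?G. \<not> hom_nonzero X Y}"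
  have C: "c k \<le> c j" if "j < k" "k < n" "c k \<le> j" for j k
    using that assms by (auto simp: torsion_code_def)
  have "\<exists>Y\<in>F. hom_nonzero X Y" if X: "X \<in> balls n" "X \<notin> ?G" for X
  proof -
    obtain i j where ij: "X = (i, j)" by force
    have b: "1 \<le> i" "i \<le> j" "j \<le> n - 1" using X by (auto simp: balls_def ij)
    \<comment> \<open>\<open>[i, l]\<close> is the torsion part of \<open>[i, j]\<close>, which is zero if \<open>l = i - 1\<close>;
      the quotient \<open>[l + 1, j]\<close> is the required torsion-free ball.\<close>
    define P where "P l \<longleftrightarrow> l = i - 1 \<or> l \<le> j \<and> (i, l) \<in> ?G" for l
    define l where "l = (GREATEST l. P l)"
    have bound: "\<And>l. P l \<Longrightarrow> l \<le> j" using b by (auto simp: P_def)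
    have Pl: "P l" unfolding l_def by (rule GreatestI_nat[of P "i - 1", OF _ bound]) (simp add: P_def)
    have max: "l' \<le> l" if "P l'" for l'
      unfolding l_def by (rule Greatest_le_nat[of P _ j, OF that bound])
    have "l \<noteq> j" using Pl X b by (auto simp: P_def ij)
    then have lj: "l < j" using bound[OF Pl] by simp
    have il: "i \<le> Suc l" using max[of "i - 1"] by (simp add: P_def)
    have "(Suc l, j) \<in> F"
      unfolding F_def
    proof safe
      show "(Suc l, j) \<in> balls n" using lj b by (simp add: balls_def)
      fix i' j' assume G: "(i', j') \<in> ?G" and "hom_nonzero (i', j') (Suc l, j)"
      then have h: "i' \<le> Suc l" "Suc l \<le> j'" "j' \<le> j" by auto
      have cj': "c j' \<le> l" "j' \<le> n - 1" using G h by (auto simp: class_of_code_def balls_def)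
      \<comment> \<open>This puts \<open>(i, j')\<close> into the class with \<open>l < j'\<close>,
        against the maximality of \<open>l\<close>.\<close>
      have "c j' < i"
      proof (cases "l = i - 1")
        case True
        then show ?thesis using cj' b by simp
      next
        case False
        then have "c l < i" using Pl by (auto simp: P_def class_of_code_def)
        moreover have "c j' \<le> c l" using C cj' h by simp
        ultimately show ?thesis by simp
      qed
      then have "P j'" using b cj' h il by (auto simp: P_def class_of_code_def balls_def)
      then show False using max[of j'] h by simp
    qed
    moreover have "hom_nonzero X (Suc l, j)" using il lj by (simp add: ij)
    ultimately show ?thesis by blast
  qed
  moreover have "?G \<subseteq> balls n" by (auto simp: class_of_code_def)
  ultimately have "torsion_pair n ?G F" unfolding torsion_pair_def F_def by blast
  then show ?thesis by (auto simp: torsion_class_def)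
qed

section \<open>The baseball construction column by column\<close>

text \<open>The head of \<open>xs\<close> is related both ways to everything before it in
  \<open>ys\<close>, so it commutes to the front. A general \<open>R\<close> leaves room for pairs
  that commute for reasons other than equal keys.\<close>

lemma fold_order_irrelevant:
  assumes comm: "\<And>x y s. x \<in> A \<Longrightarrow> y \<in> A \<Longrightarrow> R x y \<Longrightarrow> R y x \<Longrightarrow> f x (f y s) = f y (f x s)"
  shows "distinct xs \<Longrightarrow> distinct ys \<Longrightarrow> set xs = set ys \<Longrightarrow> set xs \<subseteq> A \<Longrightarrow>
    sorted_wrt R xs \<Longrightarrow> sorted_wrt R ys \<Longrightarrow> fold f xs s = fold f ys s"
proof (induction xs arbitrary: ys s)
  case (Cons x xs)
  then obtain as bs where ys: "ys = as @ x # bs"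
    by (metis list.set_intros(1) split_list)
  have as: "set as \<subseteq> A" "x \<in> A" "\<forall>a\<in>set as. R x a \<and> R a x"
    using Cons.prems unfolding ys by (auto simp: sorted_wrt_append)
  have "fold f as (f x s) = f x (fold f as s)" for s
    using as
  proof (induction as arbitrary: s)
    case (Cons a as)
    have "f a (f x s) = f x (f a s)" using Cons.prems by (intro comm) auto
    then show ?case using Cons by simp
  qed simp
  moreover have "fold f xs (f x s) = fold f (as @ bs) (f x s)"
    by (rule Cons.IH) (use Cons.prems in \<open>auto simp: ys sorted_wrt_append\<close>)
  ultimately show ?case unfolding ys by simp
qed simp

definition column :: "nat \<Rightarrow> ball list" where
  "column j = map (\<lambda>i. (i, j)) (rev [1..<Suc j])"

definition column_order :: "nat \<Rightarrow> ball list" where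
  "column_order n = concat (map column (rev [1..<n]))"

lemma set_column: "set (column j) = {(i, j') | i j'. j' = j \<and> 1 \<le> i \<and> i \<le> j}"
  by (auto simp: column_def)

lemma sorted_wrt_column: "sorted_wrt (\<lambda>X Y. snd X = snd Y \<and> fst X > fst Y) (column j)"
  unfolding column_def by (simp add: sorted_wrt_map sorted_wrt_rev del: upt_Suc)

lemma sorted_wrt_column_order:
  "sorted_wrt (\<lambda>X Y. snd X > snd Y \<or> snd X = snd Y \<and> fst X > fst Y) (column_order n)"
proof -
  have "sorted_wrt (\<lambda>X Y. snd X > snd Y \<or> snd X = snd Y \<and> fst X > fst Y) (concat (map column js))"
    if "sorted_wrt (>) js" for js
    using that
  proof (induction js)
    case (Cons j js)
    have "sorted_wrt (\<lambda>X Y. snd X > snd Y \<or> snd X = snd Y \<and> fst X > fst Y) (column j)"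
      by (rule sorted_wrt_mono_rel[OF _ sorted_wrt_column]) auto
    then show ?case using Cons by (auto simp: sorted_wrt_append set_column)
  qed simp
  then show ?thesis by (simp add: column_order_def sorted_wrt_rev)
qed

lemma set_column_order: "set (column_order n) = balls n"
  by (auto simp: column_order_def set_column balls_def)

lemma distinct_column_order: "distinct (column_order n)"
  unfolding distinct_conv_nth using sorted_wrt_column_order[of n]
  by (metis (mono_tags, lifting) linorder_neqE_nat order_less_irrefl sorted_wrt_nth_less)

lemma baseball_column_order: "baseball n G = fold (ball_step n G) (column_order n) [1..<n + 1]"
proof -
  \<comment> \<open>Balls whose values of \<open>j - i\<close> differ by at least 2 exchange
    disjoint pairs of positions.\<close>
  define far where "far X Y \<longleftrightarrow>
    snd X - fst X + 2 \<le> snd Y - fst Y \<or> snd Y - fst Y + 2 \<le> snd X - fst X" for X Y :: ball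
  define R where "R X Y \<longleftrightarrow> far X Y \<or> fst Y + snd Y \<le> fst X + snd X" for X Y :: ball
  have far_comm: "ball_step n G X (ball_step n G Y xs) = ball_step n G Y (ball_step n G X xs)"
    if XY: "X \<in> balls n" "Y \<in> balls n" "far X Y" for X Y xs
  proof -
    obtain i j where X: "X = (i, j)" by force
    obtain i' j' where Y: "Y = (i', j')" by force
    define k l where "k = n - 1 - (j - i)" and "l = n - 1 - (j' - i')"
    have "k + 2 \<le> l \<and> 1 \<le> k \<or> l + 2 \<le> k \<and> 1 \<le> l"
      using XY unfolding k_def l_def by (auto simp: X Y far_def balls_def)
    then have "exchange k (exchange l xs) = exchange l (exchange k xs)"
      by (metis exchange_commute)
    then show ?thesis
      unfolding X Y ball_step.simps k_def[symmetric] l_def[symmetric]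
      by (cases "(i, j) \<in> G"; cases "(i', j') \<in> G") simp_all
  qed
  \<comment> \<open>If \<open>snd X > snd Y\<close> but \<open>Y\<close> has the larger coordinate
    sum, then \<open>fst Y\<close> exceeds \<open>fst X\<close> by at least 2, so the two balls are
    far apart.\<close>
  have "R X Y" if "X \<in> balls n" "Y \<in> balls n" "snd X > snd Y \<or> snd X = snd Y \<and> fst X > fst Y"
    for X Y
    using that by (cases X; cases Y) (auto simp: R_def far_def balls_def)
  then have sorted: "sorted_wrt R (column_order n)"
    using sorted_wrt_mono_rel[OF _ sorted_wrt_column_order] by (simp add: set_column_order)
  have comm: "ball_step n G X (ball_step n G Y xs) = ball_step n G Y (ball_step n G X xs)"
    if "X \<in> balls n" "Y \<in> balls n" "R X Y" "R Y X" for X Y xs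
    using that far_comm[of X Y xs] far_comm[of Y X xs] ball_step_commute[of X n Y G xs]
    unfolding R_def by force
  have "sorted_wrt R (ball_order n)"
    by (rule sorted_wrt_mono_rel[of _ "\<lambda>X Y. fst X + snd X \<ge> fst Y + snd Y"])
       (use admissible_ball_order[of n] in \<open>auto simp: R_def admissible_order_def\<close>)
  then show ?thesis
    unfolding baseball_def
    using admissible_ball_order[of n] sorted
    by (intro fold_order_irrelevant[where A = "balls n" and R = R] comm)
       (auto simp: admissible_order_def set_column_order distinct_column_order)
qed

text \<open>\<open>exchange (length us + i)\<close> swaps indices \<open>i - 1\<close> and
  \<open>i\<close> of \<open>xs\<close>. For \<open>i = c, ..., 1\<close> in turn, the entry at
  index \<open>c\<close> travels to the front and the others keep their order.\<close>

lemma fold_exchange: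
  assumes "c < length xs"
  shows "fold (\<lambda>i. exchange (length us + i)) (rev [1..<Suc c]) (us @ xs) =
    us @ xs ! c # remove_nth c xs"
  using assms
proof (induction c arbitrary: xs)
  case 0
  then show ?case by (cases xs) (auto simp: remove_nth_def)
next
  case (Suc c)
  define as where "as = take c xs"
  obtain x y bs where xs: "xs = as @ x # y # bs" and as: "length as = c"
  proof
    show "xs = as @ xs ! c # xs ! Suc c # drop (Suc (Suc c)) xs"
      using Suc.prems by (simp add: as_def Cons_nth_drop_Suc)
    show "length as = c" using Suc.prems by (simp add: as_def)
  qed
  have "exchange (length us + Suc c) (us @ xs) = us @ as @ y # x # bs"
    by (simp add: exchange_def xs nth_append list_update_append as)
  then show ?case
    using Suc.IH[of "as @ y # x # bs"] as by (simp add: xs remove_nth_def nth_append)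
qed

text \<open>By decreasing \<open>i\<close> the baseballs come first and change nothing; the
  cross-balls then act as in \<open>fold_exchange\<close>, because
  \<open>length us = n - 1 - j\<close>.\<close>

lemma fold_column:
  assumes "length us + length xs = n" "length xs = Suc j" "c j \<le> j"
  shows "fold (ball_step n (class_of_code n c)) (column j) (us @ xs) =
    us @ xs ! c j # remove_nth (c j) xs"
proof -
  have "rev [1..<Suc j] = rev [Suc (c j)..<Suc j] @ rev [1..<Suc (c j)]"
    using upt_add_eq_append[of 1 "Suc (c j)" "j - c j"] assms(3)
    by (metis Suc_eq_plus1 add_Suc le_add2 le_add_diff_inverse rev_append)
  then have split: "column j =
      map (\<lambda>i. (i, j)) (rev [Suc (c j)..<Suc j]) @ map (\<lambda>i. (i, j)) (rev [1..<Suc (c j)])"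
    unfolding column_def by (metis map_append)
  have baseballs: "fold (ball_step n (class_of_code n c)) (map (\<lambda>i. (i, j)) is) ys = ys"
    if "set is \<subseteq> {Suc (c j)..j}" for "is" ys
    using that assms by (induction "is") (auto simp: class_of_code_def balls_def)
  have crosses: "fold (ball_step n (class_of_code n c)) (map (\<lambda>i. (i, j)) is) ys =
      fold (\<lambda>i. exchange (length us + i)) is ys"
    if "set is \<subseteq> {1..c j}" for "is" ys
    using that
  proof (induction "is" arbitrary: ys)
    case (Cons i "is")
    have "n - 1 - (j - i) = length us + i" using Cons.prems assms by auto
    then show ?case using Cons by (simp add: class_of_code_def)
  qed simp
  have sub: "set (rev [Suc (c j)..<Suc j]) \<subseteq> {Suc (c j)..j}" "set (rev [1..<Suc (c j)]) \<subseteq> {1..c j}"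
    by auto
  show ?thesis
    unfolding split fold_append comp_apply baseballs[OF sub(1)] crosses[OF sub(2)]
    by (rule fold_exchange) (use assms in simp)
qed

text \<open>The prefix \<open>us\<close> is final: later columns act to its right, and each settles
  one more entry, like one step of \<open>decode\<close>.\<close>

lemma fold_columns:
  assumes "length us + length xs = n" "length xs = Suc j" "\<And>k. k < n \<Longrightarrow> c k \<le> k"
  shows "fold (ball_step n (class_of_code n c)) (concat (map column (rev [1..<Suc j]))) (us @ xs) =
    us @ decode c (Suc j) xs"
  using assms(1,2)
proof (induction j arbitrary: us xs)
  case 0
  \<comment> \<open>No column remains, and \<open>decode\<close> must pick the single entry
    left.\<close>
  then have "c 0 = 0" using assms(3)[of 0] by simp
  then show ?case using 0 by (cases xs) auto
next
  case (Suc j)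
  have le: "c (Suc j) \<le> Suc j" using assms(3) Suc.prems by simp
  let ?us = "us @ [xs ! c (Suc j)]" and ?xs = "remove_nth (c (Suc j)) xs"
  have len: "length ?xs = Suc j" using le Suc.prems by (simp add: length_remove_nth)
  have "fold (ball_step n (class_of_code n c)) (column (Suc j)) (us @ xs) = ?us @ ?xs"
    using fold_column[where c = c, OF Suc.prems le] by simp
  moreover have "fold (ball_step n (class_of_code n c)) (concat (map column (rev [1..<Suc j])))
      (?us @ ?xs) = ?us @ decode c (Suc j) ?xs"
    by (rule Suc.IH) (use len Suc.prems in auto)
  ultimately show ?case by simp
qed

section \<open>From torsion codes to the bijection\<close>

lemma baseball_eq_decode:
  assumes "n \<ge> 1" "\<And>j. j < n \<Longrightarrow> c j \<le> j"
  shows "baseball n (class_of_code n c) = decode c n [1..<n + 1]"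
  using fold_columns[of "[]" "[1..<n + 1]" n "n - 1" c] assms
  by (simp add: baseball_column_order column_order_def del: upt_Suc)

text \<open>The substitution \<open>j = n - 1 - q\<close>, \<open>k = n - 1 - p\<close> turns the
  Lehmer condition for avoidance into the second clause of \<open>torsion_code\<close>.\<close>

lemma torsion_code_iff_avoids_213:
  assumes "sorted_wrt (<) xs" "length xs = n" "\<And>j. j < n \<Longrightarrow> c j \<le> j"
  shows "torsion_code n c \<longleftrightarrow> avoids_213 (decode c n xs)"
proof -
  have leh: "lehmer (decode c n xs) p = c (n - 1 - p)" if "p < n" for p
    using lehmer_decode[OF assms] that by simp
  have "avoids_213 (decode c n xs) \<longleftrightarrow>
      (\<forall>p q. p < q \<longrightarrow> q < n \<longrightarrow> c (n - 1 - p) \<le> n - 1 - q \<longrightarrow> c (n - 1 - p) \<le> c (n - 1 - q))"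
    using avoids_213_iff_lehmer[of "decode c n xs" n] decode_permutation[OF assms]
    by (simp add: leh cong: imp_cong)
  also have "\<dots> \<longleftrightarrow> (\<forall>j k. j < k \<longrightarrow> k < n \<longrightarrow> c k \<le> j \<longrightarrow> c k \<le> c j)"
  proof safe
    fix j k
    assume "\<forall>p q. p < q \<longrightarrow> q < n \<longrightarrow> c (n - 1 - p) \<le> n - 1 - q \<longrightarrow> c (n - 1 - p) \<le> c (n - 1 - q)"
      "j < k" "k < n" "c k \<le> j"
    then show "c k \<le> c j"
      by (elim allE[of _ "n - 1 - k"] allE[of _ "n - 1 - j"]) simp
  next
    fix p q
    assume "\<forall>j k. j < k \<longrightarrow> k < n \<longrightarrow> c k \<le> j \<longrightarrow> c k \<le> c j"
      "p < q" "q < n" "c (n - 1 - p) \<le> n - 1 - q"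
    then show "c (n - 1 - p) \<le> c (n - 1 - q)" by simp
  qed
  finally show ?thesis using assms(3) by (simp add: torsion_code_def)
qed

theorem mainTheorem9:
  fixes n :: nat
  assumes "n \<ge> 1"
  shows "bij_betw (baseball n) {G. torsion_class n G}
           {p \<in> permutations_of_set {1..n}. avoids_213 p}"
proof -
  let ?xs = "[1..<n + 1]"
  have xs: "sorted_wrt (<) ?xs" "length ?xs = n" "set ?xs = {1..n}"
    by (auto simp: sorted_wrt_upt simp del: upt_Suc)
  have bb: "baseball n (class_of_code n c) = decode c n ?xs" if "torsion_code n c" for c
    using that assms by (intro baseball_eq_decode) (auto simp: torsion_code_def)
  show ?thesis
  proof (rule bij_betw_imageI[OF inj_onI subset_antisym[OF subsetI subsetI]])
    fix G H
    assume "G \<in> {G. torsion_class n G}" "H \<in> {G. torsion_class n G}"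
      and eq: "baseball n G = baseball n H"
    then obtain c d where c: "torsion_code n c" "G = class_of_code n c"
      and d: "torsion_code n d" "H = class_of_code n d"
      using torsion_class_imp_code by blast
    \<comment> \<open>Both codes are the Lehmer code of the common image.\<close>
    have "c j = d j" if "j < n" for j
      using lehmer_decode[OF xs(1,2), of c "n - 1 - j"] lehmer_decode[OF xs(1,2), of d "n - 1 - j"]
        bb[OF c(1)] bb[OF d(1)] eq c d that by (auto simp: torsion_code_def)
    \<comment> \<open>As \<open>n \<ge> 1\<close>, every ball has \<open>j < n\<close>, so agreement
      of the codes below \<open>n\<close> suffices.\<close>
    then have "(i, j) \<in> G \<longleftrightarrow> (i, j) \<in> H" for i j
      using assms by (cases "j < n") (auto simp: c d class_of_code_def balls_def)
    then show "G = H" by auto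
  next
    fix p assume "p \<in> baseball n ` {G. torsion_class n G}"
    then obtain c where c: "torsion_code n c" "p = decode c n ?xs"
      using torsion_class_imp_code bb by blast
    then have le: "\<And>j. j < n \<Longrightarrow> c j \<le> j" by (simp add: torsion_code_def)
    show "p \<in> {p \<in> permutations_of_set {1..n}. avoids_213 p}"
      using decode_permutation[OF xs(1,2) le] torsion_code_iff_avoids_213[OF xs(1,2) le] c xs(3)
      by (simp add: permutations_of_set_def del: upt_Suc)
  next
    fix p assume p: "p \<in> {p \<in> permutations_of_set {1..n}. avoids_213 p}"
    then obtain c where le: "\<forall>j<n. c j \<le> j" and c: "decode c n ?xs = p"
      using decode_surj[OF xs(1,2), of p] xs(3) by (auto simp: permutations_of_set_def)
    have "torsion_code n c"
      using torsion_code_iff_avoids_213[OF xs(1,2), of c] le c p by simp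
    then show "p \<in> baseball n ` {G. torsion_class n G}"
      using bb c torsion_class_of_code by (intro image_eqI[of _ _ "class_of_code n c"]) auto
  qed
qed

end
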